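(* Let $G\subset O(n)$ be a closed subgroup which is not transitive on $S_{n-1}$, and let $k:=\operatorname{rank}G$. Then $$\dim G\leq n-k+\frac{(k-1)(k-2)}{2}+\frac{(n-k)(n-k-1)}{2}=k^2-k(n+2)+\frac{n^2+n+2}{2}.$$
   Context: $\dim G$ is the dimension of $G$ as a (compact) Lie subgroup of $O(n)$. $\mathbb{R}^n$ carries the canonical inner product and norm $\|\cdot\|$; $S_{n-1}$ is the unit sphere. $G$ is transitive if some orbit of a unit vector equals $S_{n-1}$. For a closed non-transitive subgroup $G$ and $v\in S_{n-1}$ put $h_v(w):=\inf_{g\in G}\|w-g(v)\|$. A maximin point of the orbit $P_G(v)=\{g(v) : g\in G\}$ is a unit vector $w$ at which $h_v$ attains its maximum over $S_{n-1}$. For such $w$ let $M(v,w):=\{g(v) : g\in G,\ \|w-g(v)\|=h_v(w)\}$. The linear subspace spanned by $M(v,w)\cup\{w\}$ is called a flat subspace of $G$ belonging to the orbit of $v$. The rank of $G$, denoted $\operatorname{rank}G$, is the maximal dimension of its flat subspaces (over all $v\in S_{n-1}$ and maximin points $w$ of $P_G(v)$). *)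

theory Defs
  imports "HOL-Analysis.Analysis" "HOL-Algebra.Group"
begin

definition orthogonal_group :: "(real ^ 'n ^ 'n) monoid" where
  "orthogonal_group = \<lparr>carrier = {A. orthogonal_matrix A}, mult = (**), one = mat 1\<rparr>"

lemma group_orthogonal_group: "group (orthogonal_group :: (real ^ 'n ^ 'n) monoid)"
proof (rule groupI)
  fix A :: "real ^ 'n ^ 'n"
  assume "A \<in> carrier orthogonal_group"
  then have "transpose A \<in> carrier orthogonal_group \<and>
      transpose A \<otimes>\<^bsub>orthogonal_group\<^esub> A = \<one>\<^bsub>orthogonal_group\<^esub>"
    by (simp add: orthogonal_group_def orthogonal_matrix_def)
  then show "\<exists>B\<in>carrier orthogonal_group. B \<otimes>\<^bsub>orthogonal_group\<^esub> A = \<one>\<^bsub>orthogonal_group\<^esub>"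
    by blast
qed (auto simp: orthogonal_group_def orthogonal_matrix_mul orthogonal_matrix_id matrix_mul_assoc)

text \<open>
  A closed subgroup \<open>G\<close> of the orthogonal group is an embedded submanifold of the matrix space
  (Cartan's theorem). Its Lie algebra is the tangent space at the identity, i.e. the set of
  velocities of differentiable curves in \<open>G\<close> through the identity, and its dimension as a Lie
  group is the dimension of that space.
\<close>

definition lie_algebra :: "(real ^ 'n ^ 'n) set \<Rightarrow> (real ^ 'n ^ 'n) set" where
  "lie_algebra G = {X. \<exists>\<gamma> \<epsilon>. \<epsilon> > 0 \<and> \<gamma> 0 = mat 1 \<and>
     (\<forall>t\<in>{-\<epsilon><..<\<epsilon>}. \<gamma> t \<in> G \<and> \<gamma> differentiable (at t)) \<and>
     (\<gamma> has_vector_derivative X) (at (0::real))}"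

definition lie_dim :: "(real ^ 'n ^ 'n) set \<Rightarrow> nat" where
  "lie_dim G = dim (lie_algebra G)"

definition orbit :: "(real ^ 'n ^ 'n) set \<Rightarrow> real ^ 'n \<Rightarrow> (real ^ 'n) set" where
  "orbit G v = {g *v v | g. g \<in> G}"

definition transitive_on_sphere :: "(real ^ 'n ^ 'n) set \<Rightarrow> bool" where
  "transitive_on_sphere G \<longleftrightarrow> (\<exists>v\<in>sphere 0 1. orbit G v = sphere 0 1)"

definition orbit_dist :: "(real ^ 'n ^ 'n) set \<Rightarrow> real ^ 'n \<Rightarrow> real ^ 'n \<Rightarrow> real" where
  "orbit_dist G v w = (INF g\<in>G. norm (w - g *v v))"

definition maximin_point :: "(real ^ 'n ^ 'n) set \<Rightarrow> real ^ 'n \<Rightarrow> real ^ 'n \<Rightarrow> bool" where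
  "maximin_point G v w \<longleftrightarrow>
     w \<in> sphere 0 1 \<and> (\<forall>u\<in>sphere 0 1. orbit_dist G v u \<le> orbit_dist G v w)"

definition nearest_points :: "(real ^ 'n ^ 'n) set \<Rightarrow> real ^ 'n \<Rightarrow> real ^ 'n \<Rightarrow> (real ^ 'n) set" where
  "nearest_points G v w = {g *v v | g. g \<in> G \<and> norm (w - g *v v) = orbit_dist G v w}"

definition flat_subspace :: "(real ^ 'n ^ 'n) set \<Rightarrow> real ^ 'n \<Rightarrow> (real ^ 'n) set \<Rightarrow> bool" where
  "flat_subspace G v F \<longleftrightarrow>
     (\<exists>w. maximin_point G v w \<and> F = span (nearest_points G v w \<union> {w}))"

definition group_rank :: "(real ^ 'n ^ 'n) set \<Rightarrow> nat" where
  "group_rank G = Max {dim F | F v. v \<in> sphere 0 1 \<and> flat_subspace G v F}"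

end

theory Submission
  imports Defs
begin

text \<open>
  Let \<open>F\<close> be a flat subspace of maximal dimension, spanned by a maximin point \<open>w\<close> and the points
  \<open>p\<close> of the orbit of \<open>v\<close> nearest to \<open>w\<close>. For fixed \<open>p\<close> the function \<open>g \<mapsto> (g w) \<bullet> p\<close> is maximal
  at the identity, so every \<open>X\<close> in the Lie algebra satisfies \<open>X w \<bottom> F\<close>. The isotropy group of \<open>w\<close>
  permutes the nearest points, hence preserves \<open>F\<close>, so if \<open>X w = 0\<close> then \<open>X\<close> maps \<open>F\<close> into \<open>F\<close>.
  Thus \<open>X\<close> is determined by the \<open>n - k\<close> coordinates of \<open>X w\<close> in the orthogonal complement of \<open>F\<close>
  and by two skew-symmetric blocks, of sizes \<open>k - 1\<close> and \<open>n - k\<close>.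
\<close>

subsection \<open>Linear algebra\<close>

text \<open>Each functional is an inner product with its representing vector
  \<open>adjoint (\<phi> i) 1\<close>. The common kernel \<open>Z\<close> is the orthogonal
  complement of their span, so it has codimension at most \<open>card I\<close>. By
  \<open>inj\<close> it meets \<open>S\<close> only in 0.\<close>

lemma dim_le_card_functionals:
  fixes S :: "'a::euclidean_space set" and \<phi> :: "'i \<Rightarrow> 'a \<Rightarrow> real"
  assumes S: "subspace S" and I: "finite I" and lin: "\<And>i. i \<in> I \<Longrightarrow> linear (\<phi> i)"
    and inj: "\<And>x. x \<in> S \<Longrightarrow> (\<And>i. i \<in> I \<Longrightarrow> \<phi> i x = 0) \<Longrightarrow> x = 0"
  shows "dim S \<le> card I"
proof -
  define Y where "Y = span ((\<lambda>i. adjoint (\<phi> i) 1) ` I)"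
  define Z where "Z = {z \<in> UNIV. \<forall>y\<in>Y. orthogonal y z}"
  have Y: "subspace Y" by (simp add: Y_def)
  have Z: "subspace Z"
    unfolding Z_def using subspace_orthogonal_to_vectors[of Y] by (simp add: orthogonal_commute)
  have "dim Z + dim Y = DIM('a)"
    unfolding Z_def using dim_subspace_orthogonal_to_vectors[OF Y subspace_UNIV] by simp
  moreover have "dim Y \<le> card I"
    unfolding Y_def dim_span using dim_le_card'[of "(\<lambda>i. adjoint (\<phi> i) 1) ` I"] I
    by (meson card_image_le finite_imageI order_trans)
  moreover have "S \<inter> Z \<subseteq> {0}"
  proof clarify
    fix x assume x: "x \<in> S" "x \<in> Z"
    have "\<phi> i x = 0" if "i \<in> I" for i
    proof -
      have "adjoint (\<phi> i) 1 \<in> Y" using that by (auto simp: Y_def intro: span_base)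
      then have "x \<bullet> adjoint (\<phi> i) 1 = 0"
        using x by (auto simp: Z_def orthogonal_def inner_commute)
      then show ?thesis using adjoint_works[OF lin[OF that], of x 1] by simp
    qed
    then show "x = 0" using inj x by blast
  qed
  then have "dim (S \<inter> Z) = 0" by simp
  moreover have "dim {x + y |x y. x \<in> S \<and> y \<in> Z} + dim (S \<inter> Z) = dim S + dim Z"
    by (rule dim_sums_Int[OF S Z])
  moreover have "dim {x + y |x y. x \<in> S \<and> y \<in> Z} \<le> DIM('a)"
    by (rule dim_subset_UNIV)
  ultimately show ?thesis by linarith
qed

text \<open>Plays the role of the index pairs above the diagonal for a set without a chosen order.
  The entries of a skew form at these pairs determine all its entries on \<open>B\<close>.\<close>

lemma oriented_pairs:
  assumes "finite B"
  obtains I where "finite I" "I \<subseteq> B \<times> B" "card I = card B choose 2"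
    "\<And>b c. b \<in> B \<Longrightarrow> c \<in> B \<Longrightarrow> b \<noteq> c \<Longrightarrow> (b, c) \<in> I \<or> (c, b) \<in> I"
proof -
  from assms have "\<exists>I. finite I \<and> I \<subseteq> B \<times> B \<and> card I = card B choose 2 \<and>
    (\<forall>b\<in>B. \<forall>c\<in>B. b \<noteq> c \<longrightarrow> (b, c) \<in> I \<or> (c, b) \<in> I)"
  proof induction
    case empty
    then show ?case by simp
  next
    case (insert x B)
    then obtain I where I: "finite I" "I \<subseteq> B \<times> B" "card I = card B choose 2"
      "\<forall>b\<in>B. \<forall>c\<in>B. b \<noteq> c \<longrightarrow> (b, c) \<in> I \<or> (c, b) \<in> I" by blast
    \<comment> \<open>The new element is paired with each old one, which is Pascal's rule for
      binomial coefficients over 2.\<close>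
    have "card (I \<union> {x} \<times> B) = card I + card ({x} \<times> B)"
      using I insert by (intro card_Un_disjoint) auto
    also have "\<dots> = card (insert x B) choose 2"
      using I insert by (simp add: numeral_2_eq_2 card_cartesian_product)
    finally show ?case
      using I insert by (intro exI[of _ "I \<union> {x} \<times> B"]) auto
  qed
  then obtain I where I: "finite I" "I \<subseteq> B \<times> B" "card I = card B choose 2"
    "\<forall>b\<in>B. \<forall>c\<in>B. b \<noteq> c \<longrightarrow> (b, c) \<in> I \<or> (c, b) \<in> I" by blast
  show thesis by (rule that[OF I(1-3)]) (use I(4) in blast)
qed

lemma inner_eq_0_span:
  fixes f :: "'a::euclidean_space \<Rightarrow> 'b::euclidean_space"
  assumes "linear f" and 0: "\<And>b c. b \<in> B \<Longrightarrow> c \<in> C \<Longrightarrow> f b \<bullet> c = 0"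
    and x: "x \<in> span B" and y: "y \<in> span C"
  shows "f x \<bullet> y = 0"
proof -
  have fb: "f b \<bullet> y = 0" if "b \<in> B" for b
    using orthogonal_to_span[OF y, of "f b"] 0[OF that] by (auto simp: orthogonal_def)
  interpret linear f by fact
  show ?thesis
    using x
  proof (rule span_induct)
    show "subspace {x. f x \<bullet> y = 0}"
      by (auto simp: subspace_def add scale zero inner_add_left)
  qed (use fb in auto)
qed

text \<open>Split a vector into its components in \<open>F\<close> and in the orthogonal complement
  of \<open>F\<close>, then remove from the first its projection to the unit vector
  \<open>w\<close>.\<close>

lemma span_insert_orthogonal_slices:
  fixes F :: "'a::euclidean_space set"
  assumes F: "subspace F" and w: "w \<in> F" "norm w = 1"
  shows "span (insert w ({x \<in> F. x \<bullet> w = 0} \<union> {x. \<forall>y\<in>F. x \<bullet> y = 0})) = UNIV" (is "span ?U = _")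
proof -
  have "x \<in> span ?U" for x
  proof -
    obtain y z where yz: "y \<in> span F" "\<And>u. u \<in> span F \<Longrightarrow> orthogonal z u" "x = y + z"
      using orthogonal_subspace_decomp_exists[of F x] by blast
    have y: "y \<in> F" using yz F by (simp add: span_eq_iff[THEN iffD2])
    have "y - (y \<bullet> w) *\<^sub>R w \<in> {x \<in> F. x \<bullet> w = 0}"
      using y w F by (auto simp: inner_diff_left subspace_diff subspace_scale norm_eq_1)
    then have "y - (y \<bullet> w) *\<^sub>R w \<in> span ?U" by (auto intro: span_base)
    moreover have "z \<in> span ?U"
      using yz by (auto simp: orthogonal_def span_base intro!: span_base)
    moreover have "(y \<bullet> w) *\<^sub>R w \<in> span ?U" by (auto intro: span_base span_scale)
    ultimately have "(y - (y \<bullet> w) *\<^sub>R w) + (y \<bullet> w) *\<^sub>R w + z \<in> span ?U"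
      by (intro span_add)
    then show ?thesis using yz by simp
  qed
  then show ?thesis by auto
qed

text \<open>The three summands count coordinates: those of \<open>X *v w\<close> in the complement
  of \<open>F\<close>, and those of the two skew blocks on the complement of \<open>w\<close> in
  \<open>F\<close> and on the complement of \<open>F\<close>. It is enough that they determine
  \<open>X\<close>, so \<open>inv\<close> is needed only once \<open>X *v w = 0\<close> is
  known.\<close>

lemma dim_skew_block_subspace_le:
  fixes S :: "(real ^ 'n ^ 'n) set" and F :: "(real ^ 'n) set"
  assumes S: "subspace S" and F: "subspace F" and w: "w \<in> F" "norm w = 1"
    and skew: "\<And>X x y. X \<in> S \<Longrightarrow> (X *v x) \<bullet> y = - ((X *v y) \<bullet> x)"
    and perp: "\<And>X p. X \<in> S \<Longrightarrow> p \<in> F \<Longrightarrow> (X *v w) \<bullet> p = 0"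
    and inv: "\<And>X p q. X \<in> S \<Longrightarrow> X *v w = 0 \<Longrightarrow> p \<in> F \<Longrightarrow> (\<forall>y\<in>F. q \<bullet> y = 0)
      \<Longrightarrow> (X *v p) \<bullet> q = 0"
  shows "dim S \<le> (CARD('n) - dim F) + ((dim F - 1) choose 2) + ((CARD('n) - dim F) choose 2)"
proof -
  define S1 where "S1 = {x \<in> F. x \<bullet> w = 0}"
  define S2 where "S2 = {x. \<forall>y\<in>F. x \<bullet> y = 0}"
  have sub1: "subspace S1" using F by (auto simp: S1_def subspace_def inner_add_left)
  have sub2: "subspace S2" by (auto simp: S2_def subspace_def inner_add_left)
  have "w \<noteq> 0" using w by auto
  have dim1: "dim S1 = dim F - 1"
  proof -
    have "S1 = {y \<in> F. \<forall>x \<in> span {w}. orthogonal x y}"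
      by (auto simp: S1_def orthogonal_def span_singleton inner_commute)
    moreover have "dim (span {w}) = 1" using \<open>w \<noteq> 0\<close> by simp
    moreover have "span {w} \<subseteq> F" using F w by (simp add: span_minimal)
    ultimately show ?thesis
      using dim_subspace_orthogonal_to_vectors[of "span {w}" F] F by simp
  qed
  have dim2: "dim S2 = CARD('n) - dim F"
  proof -
    have "S2 = {y \<in> UNIV. \<forall>x \<in> F. orthogonal x y}"
      by (auto simp: S2_def orthogonal_def inner_commute)
    then show ?thesis
      using dim_subspace_orthogonal_to_vectors[OF F subspace_UNIV] by simp
  qed
  obtain B1 where B1: "B1 \<subseteq> S1" "independent B1" "card B1 = dim S1" "span B1 = S1"
    using orthonormal_basis_subspace[OF sub1] by metis
  obtain B2 where B2: "B2 \<subseteq> S2" "independent B2" "card B2 = dim S2" "span B2 = S2"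
    using orthonormal_basis_subspace[OF sub2] by metis
  have fin: "finite B1" "finite B2" using B1 B2 independent_imp_finite by auto
  obtain I1 where I1: "finite I1" "I1 \<subseteq> B1 \<times> B1" "card I1 = card B1 choose 2"
    "\<And>b c. b \<in> B1 \<Longrightarrow> c \<in> B1 \<Longrightarrow> b \<noteq> c \<Longrightarrow> (b, c) \<in> I1 \<or> (c, b) \<in> I1"
    using oriented_pairs[OF fin(1)] by metis
  obtain I2 where I2: "finite I2" "I2 \<subseteq> B2 \<times> B2" "card I2 = card B2 choose 2"
    "\<And>b c. b \<in> B2 \<Longrightarrow> c \<in> B2 \<Longrightarrow> b \<noteq> c \<Longrightarrow> (b, c) \<in> I2 \<or> (c, b) \<in> I2"
    using oriented_pairs[OF fin(2)] by metis
  \<comment> \<open>The pair \<open>(b, c)\<close> stands for the matrix entry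
    \<open>(X *v b) \<bullet> c\<close>; the mixed block between \<open>B1\<close> and
    \<open>B2\<close> is omitted because \<open>inv\<close> kills it.\<close>
  define I where "I = {w} \<times> B2 \<union> I1 \<union> I2"
  define \<phi> :: "(real ^ 'n) \<times> (real ^ 'n) \<Rightarrow> real ^ 'n ^ 'n \<Rightarrow> real"
    where "\<phi> = (\<lambda>(b, c) X. (X *v b) \<bullet> c)"
  have "dim S \<le> card I"
  proof (rule dim_le_card_functionals[OF S])
    show "finite I" using fin I1 I2 by (auto simp: I_def)
    show "linear (\<phi> i)" for i
      by (cases i) (auto simp: \<phi>_def matrix_vector_mult_add_rdistrib inner_add_left
        scaleR_matrix_vector_assoc[symmetric] intro!: linearI)
  next
    fix X assume X: "X \<in> S" and 0: "\<And>i. i \<in> I \<Longrightarrow> \<phi> i X = 0"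
    have linX: "linear ((*v) X)" by simp
    have diag: "(X *v x) \<bullet> x = 0" for x using skew[OF X, of x x] by simp
    have "(X *v w) \<bullet> c = 0" if "c \<in> B2" for c
      using 0[of "(w, c)"] that by (auto simp: I_def \<phi>_def)
    then have w2: "(X *v w) \<bullet> y = 0" if "y \<in> S2" for y
      using inner_eq_0_span[OF linX, of "{w}" B2 w y] that B2 by (auto simp: span_base)
    \<comment> \<open>Now \<open>X *v w\<close> lies in \<open>S2\<close> and is orthogonal to
      \<open>S2\<close>, hence to itself.\<close>
    have "X *v w \<in> S2" using perp[OF X] by (auto simp: S2_def)
    then have Xw: "X *v w = 0" using w2 by (metis inner_eq_zero_iff)
    have w0: "(X *v x) \<bullet> w = 0" for x using skew[OF X, of x w] Xw by simp
    have blk: "(X *v b) \<bullet> c = 0"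
      if "b \<in> B" "c \<in> B" "\<And>b c. b \<in> B \<Longrightarrow> c \<in> B \<Longrightarrow> b \<noteq> c \<Longrightarrow> (b, c) \<in> J \<or> (c, b) \<in> J"
        "J \<subseteq> I" for b c B J
    proof (cases "b = c")
      case False
      then have "\<phi> (b, c) X = 0 \<or> \<phi> (c, b) X = 0" using that 0 by blast
      then show ?thesis using skew[OF X, of b c] by (auto simp: \<phi>_def)
    qed (simp add: diag)
    have 11: "(X *v x) \<bullet> y = 0" if "x \<in> S1" "y \<in> S1" for x y
      using inner_eq_0_span[OF linX, of B1 B1 x y] blk[of _ B1 _ I1] that B1 I1(4)
      by (auto simp: I_def)
    have 22: "(X *v x) \<bullet> y = 0" if "x \<in> S2" "y \<in> S2" for x y
      using inner_eq_0_span[OF linX, of B2 B2 x y] blk[of _ B2 _ I2] that B2 I2(4)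
      by (auto simp: I_def)
    have 12: "(X *v x) \<bullet> y = 0" if "x \<in> S1" "y \<in> S2" for x y
      using inv[OF X Xw, of x y] that by (auto simp: S1_def S2_def)
    have 21: "(X *v x) \<bullet> y = 0" if "x \<in> S2" "y \<in> S1" for x y
      using 12[OF that(2,1)] skew[OF X, of x y] by simp
    have "(X *v x) \<bullet> y = 0" for x y
    proof (rule inner_eq_0_span[OF linX])
      show "x \<in> span (insert w (S1 \<union> S2))" "y \<in> span (insert w (S1 \<union> S2))"
        using span_insert_orthogonal_slices[OF F w] by (auto simp: S1_def S2_def)
      show "(X *v b) \<bullet> c = 0" if "b \<in> insert w (S1 \<union> S2)" "c \<in> insert w (S1 \<union> S2)" for b c
        using that Xw w0 11 12 21 22 by auto
    qed
    then have "X *v x = 0" for x by (metis inner_eq_zero_iff)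
    then show "X = 0" by (simp add: matrix_eq)
  qed
  also have "card I \<le> card ({w} \<times> B2) + card I1 + card I2"
    unfolding I_def by (meson add_le_mono1 card_Un_le order_trans)
  finally show ?thesis
    using B1 B2 I1 I2 dim1 dim2 by (simp add: card_cartesian_product)
qed

subsection \<open>Velocities of curves in a group of orthogonal matrices\<close>

lemma bounded_bilinear_matrix_vector_mult:
  "bounded_bilinear ((*v) :: real ^ 'n ^ 'm \<Rightarrow> real ^ 'n \<Rightarrow> real ^ 'm)"
  unfolding bilinear_conv_bounded_bilinear[symmetric] bilinear_def
  by (auto intro!: linearI simp: matrix_vector_mult_add_rdistrib matrix_vector_right_distrib
      scaleR_matrix_vector_assoc matrix_vector_mult_scaleR)

lemma bounded_bilinear_matrix_mult:
  "bounded_bilinear ((**) :: real ^ 'n ^ 'm \<Rightarrow> real ^ 'p ^ 'n \<Rightarrow> real ^ 'p ^ 'm)"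
  unfolding bilinear_conv_bounded_bilinear[symmetric] bilinear_def
  by (auto intro!: linearI simp: matrix_matrix_mult_def vec_eq_iff sum.distrib sum_distrib_left
      algebra_simps)

lemma orthogonal_matrix_inner:
  fixes A :: "real ^ 'n ^ 'n"
  assumes "orthogonal_matrix A"
  shows "(A *v x) \<bullet> (A *v y) = x \<bullet> y"
  using assms orthogonal_transformation_matrix[of "(*v) A"]
  by (auto simp: orthogonal_transformation_def matrix_of_matrix_vector_mul)

lemma orthogonal_matrix_norm:
  fixes A :: "real ^ 'n ^ 'n"
  assumes "orthogonal_matrix A"
  shows "norm (A *v x) = norm x"
  using orthogonal_matrix_inner[OF assms] by (simp add: norm_eq_sqrt_inner)

text \<open>The rows are unit vectors, and the norm of a matrix is at most the sum of its row norms.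
  With closedness this makes \<open>G\<close> compact.\<close>

lemma bounded_orthogonal_matrices: "bounded {A :: real ^ 'n ^ 'n. orthogonal_matrix A}"
proof (rule boundedI)
  fix A :: "real ^ 'n ^ 'n" assume "A \<in> {A. orthogonal_matrix A}"
  then have "norm (A $ i) = 1" for i
    by (auto simp: orthogonal_matrix_orthonormal_rows row_def)
  then show "norm A \<le> CARD('n)"
    using norm_le_l1_cart[of "\<chi> i. norm (A $ i)"] by (simp add: norm_vec_def L2_set_def)
qed

text \<open>Telescoping: an isometry makes all successive displacements equally long.\<close>

lemma norm_funpow_isometry_diff_le:
  fixes f :: "'a::real_normed_vector \<Rightarrow> 'a"
  assumes "linear f" and iso: "\<And>x. norm (f x) = norm x"
  shows "norm ((f ^^ m) u - u) \<le> m * norm (f u - u)"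
proof (induction m)
  case (Suc m)
  interpret linear f by fact
  have "norm ((f ^^ Suc m) u - u) = norm (f ((f ^^ m) u - u) + (f u - u))"
    by (simp add: diff)
  also have "\<dots> \<le> norm ((f ^^ m) u - u) + norm (f u - u)"
    using norm_triangle_ineq[of "f ((f ^^ m) u - u)"] iso by simp
  finally show ?case using Suc by (simp add: algebra_simps)
qed simp

text \<open>A discrete Taylor estimate of second order. With \<open>d = f u - u\<close>, passing
  from \<open>m\<close> to \<open>Suc m\<close> adds the error \<open>(f ^^ m) d - d\<close>, which
  the first-order bound controls; then \<open>m^2 + m\<close> is at most
  \<open>(m + 1)^2\<close>.\<close>

lemma norm_funpow_isometry_second_diff_le:
  fixes f :: "'a::real_normed_vector \<Rightarrow> 'a"
  assumes lin: "linear f" and iso: "\<And>x. norm (f x) = norm x"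
  shows "norm ((f ^^ m) u - u - m *\<^sub>R (f u - u)) \<le> (real m)\<^sup>2 * norm (f (f u - u) - (f u - u))"
proof (induction m)
  case (Suc m)
  interpret linear f by fact
  define d where "d = f u - u"
  have pw: "(f ^^ m) (x - y) = (f ^^ m) x - (f ^^ m) y" for x y
    by (induction m) (auto simp: diff)
  have "(f ^^ Suc m) u - u - Suc m *\<^sub>R d = ((f ^^ m) u - u - m *\<^sub>R d) + ((f ^^ m) d - d)"
    by (simp add: d_def pw funpow_swap1 algebra_simps)
  then have "norm ((f ^^ Suc m) u - u - Suc m *\<^sub>R d)
      \<le> norm ((f ^^ m) u - u - m *\<^sub>R d) + norm ((f ^^ m) d - d)"
    by (metis norm_triangle_ineq)
  also have "\<dots> \<le> (real m)\<^sup>2 * norm (f d - d) + m * norm (f d - d)"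
    using Suc norm_funpow_isometry_diff_le[OF lin iso, of m d] by (simp add: d_def)
  also have "\<dots> \<le> (real (Suc m))\<^sup>2 * norm (f d - d)"
    using mult_right_mono[of "(real m)\<^sup>2 + m" "(real (Suc m))\<^sup>2" "norm (f d - d)"]
    by (simp add: power2_eq_square algebra_simps)
  finally show ?case by (simp add: d_def)
qed simp

text \<open>A relaxed form of \<open>lie_algebra\<close>: the curve lives on the whole line and need
  be differentiable only at 0. This simplifies products and rescaling of curves, and an upper bound
  for the dimension of the larger set suffices.\<close>

definition velocities :: "(real ^ 'n ^ 'n) set \<Rightarrow> (real ^ 'n ^ 'n) set" where
  "velocities G = {X. \<exists>\<gamma>. \<gamma> 0 = mat 1 \<and> (\<forall>t. \<gamma> t \<in> G) \<and>
     (\<gamma> has_vector_derivative X) (at (0::real))}"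

lemma lie_algebra_subset_velocities:
  assumes "mat 1 \<in> G"
  shows "lie_algebra G \<subseteq> velocities G"
proof
  fix X assume "X \<in> lie_algebra G"
  then obtain \<gamma> \<epsilon> where *: "\<epsilon> > 0" "\<gamma> 0 = mat 1" "\<forall>t\<in>{-\<epsilon><..<\<epsilon>}. \<gamma> t \<in> G"
    "(\<gamma> has_vector_derivative X) (at (0::real))"
    unfolding lie_algebra_def by blast
  \<comment> \<open>The constant continuation may jump at the ends of the interval, which does not
    affect the derivative at 0.\<close>
  let ?\<delta> = "\<lambda>t. if t \<in> {-\<epsilon><..<\<epsilon>} then \<gamma> t else mat 1"
  have "(?\<delta> has_vector_derivative X) (at 0)"
    by (rule has_vector_derivative_transform_within_open[OF *(4), of "{-\<epsilon><..<\<epsilon>}"]) (use * in auto)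
  then show "X \<in> velocities G"
    unfolding velocities_def using * assms by (intro CollectI exI[of _ ?\<delta>]) auto
qed

lemma subspace_velocities:
  assumes one: "mat 1 \<in> G" and mul: "\<And>g h. g \<in> G \<Longrightarrow> h \<in> G \<Longrightarrow> g ** h \<in> G"
  shows "subspace (velocities G)"
  unfolding subspace_def
proof (intro conjI ballI allI)
  show "0 \<in> velocities G"
    unfolding velocities_def using one by (intro CollectI exI[of _ "\<lambda>_. mat 1"]) auto
next
  fix X Y assume "X \<in> velocities G" "Y \<in> velocities G"
  then obtain \<gamma> \<delta> where *: "\<gamma> 0 = mat 1" "\<forall>t. \<gamma> t \<in> G" "(\<gamma> has_vector_derivative X) (at 0)"
    "\<delta> 0 = mat 1" "\<forall>t. \<delta> t \<in> G" "(\<delta> has_vector_derivative Y) (at 0)"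
    unfolding velocities_def by blast
  \<comment> \<open>Both curves pass through the identity at 0, so the product rule gives the plain
    sum.\<close>
  have "((\<lambda>t. \<gamma> t ** \<delta> t) has_vector_derivative X + Y) (at 0)"
    using bounded_bilinear.has_vector_derivative[OF bounded_bilinear_matrix_mult *(3,6)] *
    by (simp add: add.commute)
  then show "X + Y \<in> velocities G"
    unfolding velocities_def using * mul
    by (intro CollectI exI[of _ "\<lambda>t. \<gamma> t ** \<delta> t"]) auto
next
  fix c X assume "X \<in> velocities G"
  then obtain \<gamma> where *: "\<gamma> 0 = mat 1" "\<forall>t. \<gamma> t \<in> G" "(\<gamma> has_vector_derivative X) (at 0)"
    unfolding velocities_def by blast
  have "((\<lambda>t. c * t) has_vector_derivative c) (at 0)"
    by (auto intro!: derivative_eq_intros)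
  then have "(\<gamma> \<circ> (\<lambda>t. c * t) has_vector_derivative c *\<^sub>R X) (at 0)"
    using vector_diff_chain_at[of "\<lambda>t. c * t" c 0 \<gamma> X] * by simp
  then show "c *\<^sub>R X \<in> velocities G"
    unfolding velocities_def using *
    by (intro CollectI exI[of _ "\<gamma> \<circ> (\<lambda>t. c * t)"]) auto
qed

text \<open>Fermat's criterion: along a curve with velocity \<open>X\<close> the function
  \<open>(\<gamma> t *v x) \<bullet> y\<close> has a maximum at 0.\<close>

lemma velocity_inner_eq_0:
  assumes "X \<in> velocities G" and le: "\<And>g. g \<in> G \<Longrightarrow> (g *v x) \<bullet> y \<le> x \<bullet> y"
  shows "(X *v x) \<bullet> y = 0"
proof -
  obtain \<gamma> where *: "\<gamma> 0 = mat 1" "\<forall>t. \<gamma> t \<in> G" "(\<gamma> has_vector_derivative X) (at 0)"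
    using assms unfolding velocities_def by blast
  have "bounded_linear (\<lambda>A. (A *v x) \<bullet> y)"
    using bounded_linear_compose[OF bounded_linear_inner_left
        bounded_bilinear.bounded_linear_left[OF bounded_bilinear_matrix_vector_mult]] .
  from bounded_linear.has_vector_derivative[OF this *(3)]
  have "((\<lambda>t. (\<gamma> t *v x) \<bullet> y) has_real_derivative (X *v x) \<bullet> y) (at 0)"
    by (simp add: has_real_derivative_iff_has_vector_derivative)
  then show ?thesis
    by (rule DERIV_local_max[of _ _ _ 1]) (use * le in auto)
qed

text \<open>Cauchy-Schwarz makes the identity a maximum of \<open>(g *v z) \<bullet> z\<close>, so
  the diagonal of the form vanishes; polarization gives skewness.\<close>

lemma velocity_skew:
  assumes X: "X \<in> velocities G" and orth: "\<And>g. g \<in> G \<Longrightarrow> orthogonal_matrix g"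
  shows "(X *v x) \<bullet> y = - ((X *v y) \<bullet> x)"
proof -
  have diag: "(X *v z) \<bullet> z = 0" for z
  proof (rule velocity_inner_eq_0[OF X])
    fix g assume "g \<in> G"
    then show "(g *v z) \<bullet> z \<le> z \<bullet> z"
      using norm_cauchy_schwarz[of "g *v z" z] orthogonal_matrix_norm[OF orth]
      by (simp add: dot_square_norm power2_eq_square)
  qed
  show ?thesis
    using diag[of "x + y"] diag[of x] diag[of y]
    by (simp add: matrix_vector_right_distrib inner_add_left inner_add_right)
qed

text \<open>
  The matrix below is a limit point of the powers \<open>\<gamma> (1 / m) ^ m\<close>. It plays the role of the
  exponential of \<open>X\<close>, and the estimate that of its Taylor expansion.
\<close>

lemma isotropy_element_of_velocity:
  fixes G :: "(real ^ 'n ^ 'n) set"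
  assumes one: "mat 1 \<in> G" and mul: "\<And>g h. g \<in> G \<Longrightarrow> h \<in> G \<Longrightarrow> g ** h \<in> G"
    and orth: "\<And>g. g \<in> G \<Longrightarrow> orthogonal_matrix g" and "closed G"
    and X: "X \<in> velocities G" and Xw: "X *v w = 0"
  obtains A where "A \<in> G" "A *v w = w"
    "\<And>u. norm (A *v u - u - X *v u) \<le> norm (X *v (X *v u))"
proof -
  obtain \<gamma> where \<gamma>: "\<gamma> 0 = mat 1" "\<forall>t. \<gamma> t \<in> G" "(\<gamma> has_vector_derivative X) (at 0)"
    using X unfolding velocities_def by blast
  \<comment> \<open>The step is \<open>1 / (m + 1)\<close>, taken \<open>m + 1\<close> times in
    \<open>P m\<close>; the shift avoids division by zero.\<close>
  define h where "h m = \<gamma> (inverse (real (Suc m)))" for m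
  define P where "P m = (((**) (h m)) ^^ Suc m) (mat 1)" for m
  have hG: "h m \<in> G" for m using \<gamma> by (simp add: h_def)
  have lin: "linear ((*v) (h m))" for m by simp
  have iso: "norm (h m *v x) = norm x" for m x using orthogonal_matrix_norm orth hG by blast
  have pow: "(((**) (h m)) ^^ j) (mat 1) \<in> G" for m j
    by (induction j) (auto simp: one mul hG)
  have PG: "P m \<in> G" for m unfolding P_def by (rule pow)
  have pow_v: "(((**) (h m)) ^^ j) (mat 1) *v u = ((*v) (h m) ^^ j) u" for m j u
    by (induction j) (auto simp: matrix_vector_mul_assoc[symmetric])
  have P: "P m *v u = ((*v) (h m) ^^ Suc m) u" for m u unfolding P_def by (rule pow_v)
  have lim: "(\<lambda>m. real (Suc m) *\<^sub>R (h m - mat 1)) \<longlonglongrightarrow> X"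
  proof -
    have "((\<lambda>t. norm ((\<gamma> t - mat 1 - t *\<^sub>R X) /\<^sub>R \<bar>t\<bar>)) \<longlongrightarrow> 0) (at 0)"
      using \<gamma>(1,3)
      by (intro tendsto_norm_zero) (simp add: has_vector_derivative_def has_derivative_at_within)
    moreover have "norm ((\<gamma> t - mat 1 - t *\<^sub>R X) /\<^sub>R \<bar>t\<bar>) = norm ((\<gamma> t - mat 1) /\<^sub>R t - X)"
      if "t \<noteq> 0" for t
    proof -
      have "(\<gamma> t - mat 1) /\<^sub>R t - X = (\<gamma> t - mat 1 - t *\<^sub>R X) /\<^sub>R t"
        using that by (simp add: scaleR_diff_right)
      then show ?thesis by simp
    qed
    ultimately have "((\<lambda>t. norm ((\<gamma> t - mat 1) /\<^sub>R t - X)) \<longlongrightarrow> 0) (at 0)"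
      by (rule Lim_transform_within[where d = 1, OF _ zero_less_one]) simp
    then have "((\<lambda>t. (\<gamma> t - mat 1) /\<^sub>R t) \<longlongrightarrow> X) (at 0)"
      by (simp add: tendsto_norm_zero_iff LIM_zero_iff)
    moreover have "filterlim (\<lambda>m. inverse (real (Suc m))) (at 0) sequentially"
      by (rule filterlim_atI[OF LIMSEQ_inverse_real_of_nat]) auto
    ultimately show ?thesis
      using filterlim_compose[of "\<lambda>t. (\<gamma> t - mat 1) /\<^sub>R t" _ "at 0"
          "\<lambda>m. inverse (real (Suc m))" sequentially]
      by (simp add: h_def)
  qed
  \<comment> \<open>The vector may vary with \<open>m\<close>, so that the limit can be iterated to
    reach \<open>X *v (X *v u)\<close>.\<close>
  have limv: "(\<lambda>m. real (Suc m) *\<^sub>R (h m *v u m - u m)) \<longlonglongrightarrow> X *v a" if "u \<longlonglongrightarrow> a" for u a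
    using bounded_bilinear.tendsto[OF bounded_bilinear_matrix_vector_mult lim that]
    by (simp add: scaleR_matrix_vector_assoc[symmetric] matrix_vector_mult_diff_rdistrib)
  have "compact G"
    using bounded_subset[OF bounded_orthogonal_matrices] orth \<open>closed G\<close>
    by (auto simp: compact_eq_bounded_closed)
  then obtain A r where A: "A \<in> G" "strict_mono r" "(P \<circ> r) \<longlonglongrightarrow> A"
    using PG unfolding compact_def by blast
  have Av: "(\<lambda>m. P (r m) *v u) \<longlonglongrightarrow> A *v u" for u
    using bounded_bilinear.tendsto[OF bounded_bilinear_matrix_vector_mult A(3) tendsto_const]
    by (simp add: o_def)
  note sub = LIMSEQ_subseq_LIMSEQ[OF _ A(2), unfolded o_def]
  show thesis
  proof
    show "A \<in> G" by fact
    \<comment> \<open>Since \<open>X *v w = 0\<close>, the first-order bound on the displacement of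
      \<open>w\<close> under \<open>P m\<close> tends to 0.\<close>
    have "(\<lambda>m. norm (real (Suc m) *\<^sub>R (h m *v w - w))) \<longlonglongrightarrow> 0"
      using tendsto_norm[OF limv[OF tendsto_const, of w]] Xw by simp
    note 0 = sub[OF this]
    have "norm (A *v w - w) \<le> 0"
    proof (rule LIMSEQ_le[OF _ 0])
      show "(\<lambda>m. norm (P (r m) *v w - w)) \<longlonglongrightarrow> norm (A *v w - w)"
        by (intro tendsto_intros Av)
      have "norm (P (r m) *v w - w) \<le> norm (real (Suc (r m)) *\<^sub>R (h (r m) *v w - w))" for m
        using norm_funpow_isometry_diff_le[OF lin iso, of "Suc (r m)" "r m" w]
        unfolding P norm_scaleR by simp
      then show "\<exists>N. \<forall>m\<ge>N. norm (P (r m) *v w - w)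
          \<le> norm (real (Suc (r m)) *\<^sub>R (h (r m) *v w - w))" by blast
    qed
    then show "A *v w = w" by simp
  next
    fix u
    have 1: "(\<lambda>m. real (Suc m) *\<^sub>R (h m *v u - u)) \<longlonglongrightarrow> X *v u" by (rule limv) simp
    let ?d = "\<lambda>m. h m *v u - u"
    have "(\<lambda>m. norm (real (Suc m) *\<^sub>R
        (h m *v (real (Suc m) *\<^sub>R ?d m) - real (Suc m) *\<^sub>R ?d m))) \<longlonglongrightarrow> norm (X *v (X *v u))"
      by (intro tendsto_norm limv 1)
    \<comment> \<open>The iterated difference quotient is exactly the bound of the second-order
      estimate for \<open>m + 1\<close> steps.\<close>
    moreover have "norm (real (Suc m) *\<^sub>R (h m *v (real (Suc m) *\<^sub>R ?d m) - real (Suc m) *\<^sub>R ?d m))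
        = (real (Suc m))\<^sup>2 * norm (h m *v ?d m - ?d m)" for m
      by (simp add: matrix_vector_mult_scaleR scaleR_diff_right[symmetric] power2_eq_square
          del: of_nat_Suc)
    ultimately have 2: "(\<lambda>m. (real (Suc m))\<^sup>2 * norm (h m *v ?d m - ?d m)) \<longlonglongrightarrow> norm (X *v (X *v u))"
      by simp
    show "norm (A *v u - u - X *v u) \<le> norm (X *v (X *v u))"
    proof (rule LIMSEQ_le[OF _ sub[OF 2]])
      show "(\<lambda>m. norm (P (r m) *v u - u - real (Suc (r m)) *\<^sub>R ?d (r m)))
          \<longlonglongrightarrow> norm (A *v u - u - X *v u)"
        by (intro tendsto_intros Av sub[OF 1])
      show "\<exists>N. \<forall>m\<ge>N. norm (P (r m) *v u - u - real (Suc (r m)) *\<^sub>R ?d (r m))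
          \<le> (real (Suc (r m)))\<^sup>2 * norm (h (r m) *v ?d (r m) - ?d (r m))"
        using norm_funpow_isometry_second_diff_le[OF lin iso] unfolding P by blast
    qed
  qed
qed

subsection \<open>Flat subspaces\<close>

text \<open>Gives continuity of the distance to the orbit, and with compactness of the sphere a
  maximin point.\<close>

lemma orbit_dist_eq_infdist:
  assumes "G \<noteq> {}"
  shows "orbit_dist G v w = infdist w (orbit G v)"
proof -
  have "orbit G v = (\<lambda>g. g *v v) ` G" by (auto simp: orbit_def)
  then show ?thesis
    using assms by (simp add: orbit_dist_def infdist_notempty image_image dist_norm)
qed

lemma orbit_dist_le:
  assumes "g \<in> G"
  shows "orbit_dist G v w \<le> norm (w - g *v v)"
  unfolding orbit_dist_def by (rule cINF_lower[OF _ assms]) (auto intro: bdd_belowI[of _ 0])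

lemma ex_maximin_point:
  fixes G :: "(real ^ 'n ^ 'n) set"
  assumes "G \<noteq> {}"
  obtains w where "maximin_point G v w"
proof -
  obtain z :: "real ^ 'n" where "norm z = 1" using vector_choose_size[of 1] by auto
  then have ne: "sphere (0 :: real ^ 'n) 1 \<noteq> {}" by (metis empty_iff mem_sphere_0)
  have cont: "continuous_on (sphere 0 1) (\<lambda>w. infdist w (orbit G v))"
    by (intro continuous_intros)
  obtain w where "w \<in> sphere 0 1"
    "\<forall>u\<in>sphere 0 1. infdist u (orbit G v) \<le> infdist w (orbit G v)"
    using continuous_attains_sup[OF compact_sphere ne cont] by blast
  then show thesis
    using that assms by (auto simp: maximin_point_def orbit_dist_eq_infdist)
qed

text \<open>The maximum in \<open>group_rank\<close> is attained: the dimensions are bounded by that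
  of the ambient space, and a maximin point supplies at least one flat subspace.\<close>

lemma ex_flat_subspace_dim_group_rank:
  fixes G :: "(real ^ 'n ^ 'n) set"
  assumes "G \<noteq> {}"
  obtains v F where "flat_subspace G v F" "dim F = group_rank G"
proof -
  let ?D = "{dim F |F v. v \<in> sphere 0 1 \<and> flat_subspace G v F}"
  have "finite ?D"
    by (rule finite_subset[of _ "{..CARD('n)}"]) (auto intro: dim_subset_UNIV_cart)
  moreover have "?D \<noteq> {}"
  proof -
    obtain v :: "real ^ 'n" where "norm v = 1" using vector_choose_size[of 1] by auto
    moreover obtain w where "maximin_point G v w" using ex_maximin_point[OF assms] .
    ultimately show ?thesis unfolding flat_subspace_def by auto
  qed
  ultimately have "Max ?D \<in> ?D" by (rule Max_in)
  then show thesis using that unfolding group_rank_def by auto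
qed

text \<open>For a nearest point \<open>q\<close>, moving \<open>g\<close> to the other side shows
  that \<open>g *v w\<close> is no closer to \<open>q\<close> than \<open>w\<close>. As
  \<open>w\<close> and \<open>g *v w\<close> have equal norms, this says that
  \<open>(g *v w) \<bullet> q\<close> is maximal at the identity. The generator \<open>w\<close> is
  covered by skewness.\<close>

lemma velocity_perp_flat:
  assumes X: "X \<in> velocities G" and orth: "\<And>g. g \<in> G \<Longrightarrow> orthogonal_matrix g"
    and mul: "\<And>g h. g \<in> G \<Longrightarrow> h \<in> G \<Longrightarrow> g ** h \<in> G"
    and tr: "\<And>g. g \<in> G \<Longrightarrow> transpose g \<in> G"
    and p: "p \<in> span (nearest_points G v w \<union> {w})"
  shows "(X *v w) \<bullet> p = 0"
proof -
  have "(X *v w) \<bullet> q = 0" if q: "q \<in> nearest_points G v w" for q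
  proof (rule velocity_inner_eq_0[OF X])
    fix g assume g: "g \<in> G"
    obtain h where h: "q = h *v v" "h \<in> G" "norm (w - q) = orbit_dist G v w"
      using q by (auto simp: nearest_points_def)
    have inv: "g *v (transpose g *v q) = q"
      using orth[OF g] by (simp add: matrix_vector_mul_assoc orthogonal_matrix_def del: transpose_matrix_vector)
    have "norm (w - q) \<le> norm (w - transpose g *v q)"
      using orbit_dist_le[OF mul[OF tr[OF g] h(2)], of v w] h
      by (simp add: matrix_vector_mul_assoc)
    also have "\<dots> = norm (g *v w - q)"
      using orthogonal_matrix_norm[OF orth[OF g], of "w - transpose g *v q"] inv
      by (simp add: matrix_vector_mult_diff_distrib)
    finally have "(norm (w - q))\<^sup>2 \<le> (norm (g *v w - q))\<^sup>2" by (simp add: power_mono)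
    then show "(g *v w) \<bullet> q \<le> w \<bullet> q"
      using orthogonal_matrix_inner[OF orth[OF g], of w w]
      by (simp add: power2_norm_eq_inner inner_diff_left inner_diff_right inner_commute)
  qed
  moreover have "(X *v w) \<bullet> w = 0" using velocity_skew[OF X orth, of w w] by simp
  ultimately have "orthogonal (X *v w) p"
    by (intro orthogonal_to_span[OF p]) (auto simp: orthogonal_def)
  then show ?thesis by (simp add: orthogonal_def)
qed

text \<open>An element \<open>A\<close> of \<open>G\<close> fixing \<open>w\<close> sends nearest
  points to nearest points, so \<open>A *v u - u\<close> is orthogonal to \<open>q\<close>. Hence
  \<open>(X *v u) \<bullet> q\<close> is bounded by a second-order remainder, and rescaling
  \<open>X\<close> forces it to vanish.\<close>

lemma isotropy_velocity_preserves_flat: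
  assumes X: "X \<in> velocities G" and Xw: "X *v w = 0"
    and orth: "\<And>g. g \<in> G \<Longrightarrow> orthogonal_matrix g" and one: "mat 1 \<in> G"
    and mul: "\<And>g h. g \<in> G \<Longrightarrow> h \<in> G \<Longrightarrow> g ** h \<in> G" and cl: "closed G"
    and p: "p \<in> span (nearest_points G v w \<union> {w})" (is "_ \<in> ?F")
    and q: "\<forall>y\<in>span (nearest_points G v w \<union> {w}). q \<bullet> y = 0"
  shows "(X *v p) \<bullet> q = 0"
proof -
  have le: "(Y *v u) \<bullet> q \<le> norm (Y *v (Y *v u)) * norm q"
    if u: "u \<in> nearest_points G v w" and Y: "Y \<in> velocities G" "Y *v w = 0" for u Y
  proof -
    obtain h where h: "u = h *v v" "h \<in> G" "norm (w - u) = orbit_dist G v w"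
      using u by (auto simp: nearest_points_def)
    obtain A where A: "A \<in> G" "A *v w = w"
      "norm (A *v u - u - Y *v u) \<le> norm (Y *v (Y *v u))"
      using isotropy_element_of_velocity[OF one mul orth cl Y] by metis
    have "norm (w - A *v u) = orbit_dist G v w"
      using orthogonal_matrix_norm[OF orth[OF A(1)], of "w - u"] A h
      by (simp add: matrix_vector_mult_diff_distrib)
    then have "A *v u \<in> nearest_points G v w"
      using mul[OF A(1) h(2)] h unfolding nearest_points_def
      by (auto simp: matrix_vector_mul_assoc)
    then have "A *v u \<in> ?F" "u \<in> ?F" using u by (auto intro: span_base)
    then have "(A *v u) \<bullet> q = 0" "u \<bullet> q = 0" using q by (auto simp: inner_commute)
    then have "(Y *v u) \<bullet> q = - ((A *v u - u - Y *v u) \<bullet> q)" by (simp add: inner_diff_left)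
    also have "\<dots> \<le> norm (A *v u - u - Y *v u) * norm q"
      using Cauchy_Schwarz_ineq2[of "A *v u - u - Y *v u" q] by linarith
    also have "\<dots> \<le> norm (Y *v (Y *v u)) * norm q" using A by (simp add: mult_right_mono)
    finally show ?thesis .
  qed
  have "subspace (velocities G)" using subspace_velocities[OF one mul] .
  then have scaled: "c *\<^sub>R X \<in> velocities G" for c using X by (rule subspace_scale)
  have base: "(X *v u) \<bullet> q = 0" if u: "u \<in> nearest_points G v w" for u
  proof -
    define a where "a = (X *v u) \<bullet> q"
    define K where "K = norm (X *v (X *v u)) * norm q"
    \<comment> \<open>The bound \<open>le\<close> for the velocity \<open>c *\<^sub>R X\<close>: the
      left side is linear in \<open>c\<close>, the right side quadratic.\<close>
    have "c * a \<le> c\<^sup>2 * K" for c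
      using le[OF u scaled[of c]] Xw
      by (simp add: a_def K_def scaleR_matrix_vector_assoc[symmetric] matrix_vector_mult_scaleR
          power2_eq_square)
    note quad = this
    have "K \<ge> 0" by (simp add: K_def)
    \<comment> \<open>With this value the inequality reads
      \<open>c^2 * (K + 1) \<le> c^2 * K\<close>; the added 1 keeps the denominator
      positive.\<close>
    define c where "c = a / (K + 1)"
    have a: "a = c * (K + 1)" using \<open>K \<ge> 0\<close> by (simp add: c_def)
    then have "c * (c * (K + 1)) \<le> c\<^sup>2 * K" using quad[of c] by simp
    then have "c\<^sup>2 \<le> 0" by (simp add: algebra_simps power2_eq_square)
    then show ?thesis using a by (simp add: a_def)
  qed
  show ?thesis
    by (rule inner_eq_0_span[of "(*v) X" "nearest_points G v w \<union> {w}" "{q}" p q])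
      (use base Xw p in \<open>auto intro: span_base\<close>)
qed

theorem theorem7:
  fixes G :: "(real ^ 'n ^ 'n) set" and n k :: real
  assumes "subgroup G orthogonal_group"
    and "closed G"
    and "\<not> transitive_on_sphere G"
  defines "n \<equiv> real CARD('n)" and "k \<equiv> real (group_rank G)"
  shows "real (lie_dim G) \<le> n - k + (k - 1) * (k - 2) / 2 + (n - k) * (n - k - 1) / 2
    \<and> n - k + (k - 1) * (k - 2) / 2 + (n - k) * (n - k - 1) / 2
        = k\<^sup>2 - k * (n + 2) + (n\<^sup>2 + n + 2) / 2"
proof
  interpret grp: group "orthogonal_group :: (real ^ 'n ^ 'n) monoid"
    by (rule group_orthogonal_group)
  interpret subgroup G orthogonal_group by fact
  have orth: "orthogonal_matrix g" if "g \<in> G" for g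
    using mem_carrier[OF that] by (simp add: orthogonal_group_def)
  have one: "mat 1 \<in> G" using one_closed by (simp add: orthogonal_group_def)
  have mul: "g ** h \<in> G" if "g \<in> G" "h \<in> G" for g h
    using m_closed[OF that] by (simp add: orthogonal_group_def)
  have tr: "transpose g \<in> G" if "g \<in> G" for g
  proof -
    have "inv\<^bsub>orthogonal_group\<^esub> g = transpose g"
      by (rule grp.inv_equality)
        (use orth[OF that] in \<open>auto simp: orthogonal_group_def orthogonal_matrix_def\<close>)
    then show ?thesis using m_inv_closed[OF that] by simp
  qed
  have "G \<noteq> {}" using one by auto
  then obtain v F where F: "flat_subspace G v F" "dim F = group_rank G"
    by (rule ex_flat_subspace_dim_group_rank)
  then obtain w where w: "maximin_point G v w" "F = span (nearest_points G v w \<union> {w})"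
    unfolding flat_subspace_def by blast
  have wF: "w \<in> F" "norm w = 1" using w by (auto simp: maximin_point_def intro: span_base)
  have subV: "subspace (velocities G)" using subspace_velocities[OF one mul] .
  have "lie_dim G \<le> dim (velocities G)"
    unfolding lie_dim_def by (rule dim_subset[OF lie_algebra_subset_velocities[OF one]])
  also have "\<dots> \<le> (CARD('n) - dim F) + ((dim F - 1) choose 2) + ((CARD('n) - dim F) choose 2)"
  proof (rule dim_skew_block_subspace_le[OF subV _ wF])
    show "subspace F" using w by simp
    show "(X *v x) \<bullet> y = - ((X *v y) \<bullet> x)" if "X \<in> velocities G" for X x y
      by (rule velocity_skew[OF that orth])
    show "(X *v w) \<bullet> p = 0" if "X \<in> velocities G" "p \<in> F" for X p
      using velocity_perp_flat[OF that(1) orth mul tr, of p v w] that w by blast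
    show "(X *v p) \<bullet> q = 0"
      if "X \<in> velocities G" "X *v w = 0" "p \<in> F" "\<forall>y\<in>F. q \<bullet> y = 0" for X p q
      using isotropy_velocity_preserves_flat[OF that(1,2) orth one mul \<open>closed G\<close>, of p v q] that w
      by blast
  qed
  finally have le: "real (lie_dim G)
      \<le> real (CARD('n) - dim F) + real ((dim F - 1) choose 2) + real ((CARD('n) - dim F) choose 2)"
    by linarith
  have choose2: "real (m choose 2) = real m * (real m - 1) / 2" for m
    by (induction m) (simp_all add: numeral_2_eq_2 field_simps)
  have "dim F \<le> CARD('n)" by (rule dim_subset_UNIV_cart)
  \<comment> \<open>Together with \<open>dim F \<le> CARD('n)\<close> this makes the natural-number
    subtractions in \<open>le\<close> agree with the real ones.\<close>
  moreover have "dim F \<noteq> 0" using wF by (auto simp: dim_eq_0)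
  ultimately show "real (lie_dim G) \<le> n - k + (k - 1) * (k - 2) / 2 + (n - k) * (n - k - 1) / 2"
    using le F unfolding choose2 n_def k_def by (simp add: of_nat_diff algebra_simps)
  show "n - k + (k - 1) * (k - 2) / 2 + (n - k) * (n - k - 1) / 2
        = k\<^sup>2 - k * (n + 2) + (n\<^sup>2 + n + 2) / 2"
    by (simp add: power2_eq_square field_simps)
qed

end
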